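(* (1) Let $\langle X_\alpha\mid\alpha\in J\rangle$ be an indexed set of sets and let $\gamma_\alpha:P(X_\alpha)\to P(X_\alpha)$ be monotonous for each $\alpha\in J$. Define $\gamma:P\left(\coprod_{\alpha\in J}X_\alpha\right)\to P\left(\coprod_{\alpha\in J}X_\alpha\right)$ by $\gamma(A):=\coprod_{\alpha\in J}\gamma_\alpha(A\cap X_\alpha)$. Then $$\left(\coprod_{\alpha\in J}X_\alpha,\mu(\gamma)\right)=\coprod_{\alpha\in J}\left(X_\alpha,\mu(\gamma_\alpha)\right).$$ (2) Let $X$ be a set, let $\gamma:P(X)\to P(X)$ be monotonous, and let $X_0\subset X$. Define $\gamma_0:P(X_0)\to P(X_0)$ by $\gamma_0A_0:=(\gamma A_0)\cap X_0$. Then $$\mu(\gamma_0)\subset\mu(\gamma)|X_0.$$ The converse inclusion is false in general, even if $\gamma$ is completely additive and $\gamma(P(X))=\{\emptyset,X\}$; that is, there exist a set $X$, a subset $X_0\subset X$ and a completely additive $\gamma:P(X)\to P(X)$ with $\gamma(P(X))=\{\emptyset,X\}$ such that $\mu(\gamma)|X_0\not\subset\mu(\gamma_0)$.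
   Context: A generalized topology (GT) on a set $X$ is a family $\mu\subset P(X)$ with $\emptyset\in\mu$ closed under arbitrary unions; $(X,\mu)$ is a generalized topological space. A map $\gamma:P(X)\to P(X)$ is monotonous if $A\subset B$ implies $\gamma A\subset\gamma B$. For monotonous $\gamma$, $\mu(\gamma):=\{A\subset X\mid A\subset\gamma A\}$, which is a GT on $X$. $\gamma$ is completely additive if $\gamma\left(\bigcup_{\alpha\in J}A_\alpha\right)=\bigcup_{\alpha\in J}\gamma(A_\alpha)$ for every family $\{A_\alpha\mid\alpha\in J\}\subset P(X)$. For $\mathcal{A}\subset P(X)$ and $X_0\subset X$, $\mathcal{A}|X_0:=\{A\cap X_0\mid A\in\mathcal{A}\}$. $\coprod_{\alpha\in J}X_\alpha$ is the disjoint union, with each $X_\alpha$ identified with its image, so the $X_\alpha$ are pairwise disjoint subsets with union $\coprod_\alpha X_\alpha$. The sum $\coprod_{\alpha\in J}(X_\alpha,\mu_\alpha)$ of GTS's is $\coprod_\alpha X_\alpha$ with the GT $\{\bigcup_{\alpha\in J}N_\alpha\mid N_\alpha\in\mu_\alpha\text{ for all }\alpha\in J\}$. *)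

theory Defs
  imports Main "HOL-Library.FuncSet"
begin

text \<open>
  Sets are carriers \<open>X :: 'a set\<close>. A map \<open>P(X) \<rightarrow> P(X)\<close> is a total function on \<open>'a set\<close>
  of which only the values on \<open>Pow X\<close> are ever used.
\<close>

definition generalized_topology :: "'a set \<Rightarrow> 'a set set \<Rightarrow> bool" where
  "generalized_topology X \<mu> \<longleftrightarrow> \<mu> \<subseteq> Pow X \<and> {} \<in> \<mu> \<and> (\<forall>\<U>. \<U> \<subseteq> \<mu> \<longrightarrow> \<Union>\<U> \<in> \<mu>)"

type_synonym 'a gts = "'a set \<times> 'a set set"

definition monotonous :: "'a set \<Rightarrow> ('a set \<Rightarrow> 'a set) \<Rightarrow> bool" where
  "monotonous X \<gamma> \<longleftrightarrow> \<gamma> \<in> Pow X \<rightarrow> Pow X \<and> mono_on (Pow X) \<gamma>"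

text \<open>The empty family is included, so that in particular \<open>\<gamma> {} = {}\<close>.\<close>

definition completely_additive :: "'a set \<Rightarrow> ('a set \<Rightarrow> 'a set) \<Rightarrow> bool" where
  "completely_additive X \<gamma> \<longleftrightarrow>
     \<gamma> \<in> Pow X \<rightarrow> Pow X \<and> (\<forall>\<A>. \<A> \<subseteq> Pow X \<longrightarrow> \<gamma> (\<Union>\<A>) = (\<Union>A\<in>\<A>. \<gamma> A))"

definition gt_of :: "'a set \<Rightarrow> ('a set \<Rightarrow> 'a set) \<Rightarrow> 'a set set" where
  "gt_of X \<gamma> = {A. A \<subseteq> X \<and> A \<subseteq> \<gamma> A}"

definition restrict_family :: "'a set set \<Rightarrow> 'a set \<Rightarrow> 'a set set" where
  "restrict_family \<A> X0 = {A \<inter> X0 | A. A \<in> \<A>}"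

text \<open>
  The disjoint union of \<open>X \<alpha>\<close>, \<open>\<alpha> \<in> J\<close>, is \<open>Sigma J X\<close>, with \<open>X \<alpha>\<close> embedded by \<open>Pair \<alpha>\<close>.
  Under this identification the union of sets \<open>N \<alpha> \<subseteq> X \<alpha>\<close> is \<open>Sigma J N\<close>, and
  \<open>A \<inter> X \<alpha>\<close> is \<open>Pair \<alpha> -` A \<inter> X \<alpha>\<close>.
\<close>

definition gts_sum :: "'i set \<Rightarrow> ('i \<Rightarrow> 'a gts) \<Rightarrow> ('i \<times> 'a) gts" where
  "gts_sum J G =
     (Sigma J (\<lambda>\<alpha>. fst (G \<alpha>)), {Sigma J N | N. \<forall>\<alpha>\<in>J. N \<alpha> \<in> snd (G \<alpha>)})"

definition sum_op ::
    "'i set \<Rightarrow> ('i \<Rightarrow> 'a set) \<Rightarrow> ('i \<Rightarrow> 'a set \<Rightarrow> 'a set) \<Rightarrow> ('i \<times> 'a) set \<Rightarrow> ('i \<times> 'a) set" where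
  "sum_op J X \<gamma> A = Sigma J (\<lambda>\<alpha>. \<gamma> \<alpha> (Pair \<alpha> -` A \<inter> X \<alpha>))"

definition subspace_op :: "'a set \<Rightarrow> ('a set \<Rightarrow> 'a set) \<Rightarrow> 'a set \<Rightarrow> 'a set" where
  "subspace_op X0 \<gamma> A0 = \<gamma> A0 \<inter> X0"

lemma generalized_topology_gt_of:
  assumes "monotonous X \<gamma>"
  shows "generalized_topology X (gt_of X \<gamma>)"
proof -
  have "\<Union>\<U> \<subseteq> \<gamma> (\<Union>\<U>)" if \<U>: "\<U> \<subseteq> gt_of X \<gamma>" for \<U>
  proof
    fix x assume "x \<in> \<Union>\<U>"
    then obtain A where A: "A \<in> \<U>" "x \<in> A" by blast
    then have "x \<in> \<gamma> A" "A \<in> Pow X" "\<Union>\<U> \<in> Pow X"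
      using \<U> unfolding gt_of_def by blast+
    moreover have "\<gamma> A \<subseteq> \<gamma> (\<Union>\<U>)"
      using assms calculation(2,3) A(1) unfolding monotonous_def
      by (meson Union_upper mono_onD)
    ultimately show "x \<in> \<gamma> (\<Union>\<U>)" by blast
  qed
  then show ?thesis
    unfolding generalized_topology_def by (auto simp: gt_of_def)
qed

lemma completely_additive_imp_monotonous:
  assumes "completely_additive X \<gamma>"
  shows "monotonous X \<gamma>"
  unfolding monotonous_def
proof (intro conjI mono_onI)
  show "\<gamma> \<in> Pow X \<rightarrow> Pow X" using assms by (simp add: completely_additive_def)
next
  fix A B assume AB: "A \<in> Pow X" "B \<in> Pow X" "A \<subseteq> B"
  then have "{A, B} \<subseteq> Pow X" by simp
  then have "\<gamma> (\<Union>{A, B}) = (\<Union>C\<in>{A, B}. \<gamma> C)"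
    using assms unfolding completely_additive_def by (elim conjE allE impE)
  moreover have "\<Union>{A, B} = B" using AB by auto
  ultimately have "\<gamma> B = (\<Union>C\<in>{A, B}. \<gamma> C)" by (simp only:)
  then show "\<gamma> A \<subseteq> \<gamma> B" by blast
qed

lemma monotonous_sum_op:
  assumes "\<And>\<alpha>. \<alpha> \<in> J \<Longrightarrow> monotonous (X \<alpha>) (\<gamma> \<alpha>)"
  shows "monotonous (Sigma J X) (sum_op J X \<gamma>)"
  unfolding monotonous_def
proof (intro conjI mono_onI)
  show "sum_op J X \<gamma> \<in> Pow (Sigma J X) \<rightarrow> Pow (Sigma J X)"
    using assms unfolding monotonous_def sum_op_def by (fastforce simp: Pi_iff)
next
  fix A B :: "('a \<times> 'b) set" assume "A \<subseteq> B"
  then have "\<gamma> \<alpha> (Pair \<alpha> -` A \<inter> X \<alpha>) \<subseteq> \<gamma> \<alpha> (Pair \<alpha> -` B \<inter> X \<alpha>)" if "\<alpha> \<in> J" for \<alpha>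
    using assms[OF that] unfolding monotonous_def
    by (elim conjE, rule_tac mono_onD[where f = "\<gamma> \<alpha>"]) auto
  then show "sum_op J X \<gamma> A \<subseteq> sum_op J X \<gamma> B"
    unfolding sum_op_def by (intro Sigma_mono order_refl)
qed

lemma monotonous_subspace_op:
  assumes "monotonous X \<gamma>" "X0 \<subseteq> X"
  shows "monotonous X0 (subspace_op X0 \<gamma>)"
  unfolding monotonous_def
proof (intro conjI mono_onI)
  show "subspace_op X0 \<gamma> \<in> Pow X0 \<rightarrow> Pow X0" by (auto simp: subspace_op_def)
next
  fix A B assume "A \<in> Pow X0" "B \<in> Pow X0" "A \<subseteq> B"
  then have "\<gamma> A \<subseteq> \<gamma> B"
    using assms mono_onD[of "Pow X" \<gamma> A B] unfolding monotonous_def by auto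
  then show "subspace_op X0 \<gamma> A \<subseteq> subspace_op X0 \<gamma> B" by (auto simp: subspace_op_def)
qed

lemma generalized_topology_gts_sum:
  assumes "\<And>\<alpha>. \<alpha> \<in> J \<Longrightarrow> generalized_topology (fst (G \<alpha>)) (snd (G \<alpha>))"
  shows "generalized_topology (fst (gts_sum J G)) (snd (gts_sum J G))"
proof -
  have closed: "\<Union>\<U> \<in> snd (gts_sum J G)" if \<U>: "\<U> \<subseteq> snd (gts_sum J G)" for \<U>
  proof -
    define N where "N \<alpha> = \<Union>((\<lambda>S. Pair \<alpha> -` S) ` \<U>)" for \<alpha>
    have slice: "S \<subseteq> Sigma J (\<lambda>\<alpha>. Pair \<alpha> -` S) \<and> (\<forall>\<alpha>\<in>J. Pair \<alpha> -` S \<in> snd (G \<alpha>))"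
      if S: "S \<in> \<U>" for S
    proof -
      obtain M where M: "S = Sigma J M" "\<forall>\<alpha>\<in>J. M \<alpha> \<in> snd (G \<alpha>)"
        using S \<U> unfolding gts_sum_def by auto
      have "Pair \<alpha> -` S = M \<alpha>" if "\<alpha> \<in> J" for \<alpha> using that M(1) by auto
      with M show ?thesis by auto
    qed
    have "\<Union>\<U> \<subseteq> Sigma J N" using slice unfolding N_def by blast
    moreover have "Sigma J N \<subseteq> \<Union>\<U>" unfolding N_def by auto
    ultimately have "\<Union>\<U> = Sigma J N" by (rule subset_antisym)
    moreover have "N \<alpha> \<in> snd (G \<alpha>)" if "\<alpha> \<in> J" for \<alpha>
    proof -
      have "(\<lambda>S. Pair \<alpha> -` S) ` \<U> \<subseteq> snd (G \<alpha>)" using slice that by blast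
      then show ?thesis
        using assms[OF that] unfolding N_def generalized_topology_def by simp
    qed
    ultimately show ?thesis unfolding gts_sum_def by auto
  qed
  have "S \<subseteq> fst (gts_sum J G)" if S: "S \<in> snd (gts_sum J G)" for S
  proof -
    obtain M where M: "S = Sigma J M" "\<forall>\<alpha>\<in>J. M \<alpha> \<in> snd (G \<alpha>)"
      using S unfolding gts_sum_def by auto
    have "M \<alpha> \<subseteq> fst (G \<alpha>)" if "\<alpha> \<in> J" for \<alpha>
      using assms[OF that] M(2) that unfolding generalized_topology_def by blast
    with M(1) show ?thesis unfolding gts_sum_def by auto
  qed
  moreover have "{} \<in> snd (gts_sum J G)" using closed[of "{}"] by simp
  ultimately show ?thesis using closed unfolding generalized_topology_def by blast
qed

end

theory Submission
  imports Defs
begin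

text \<open>
  Both the condition \<open>A \<subseteq> \<gamma> A\<close> for the sum operation and the sets of the sum topology are
  determined slice by slice: a subset of the disjoint union is the union of its slices, and it lies
  in its image exactly when each slice lies in the image of that slice. This gives the first part.

  In the second part a set \<open>A \<subseteq> X0\<close> with \<open>A \<subseteq> \<gamma> A \<inter> X0\<close> is already open in \<open>X\<close>, so it is its own
  trace. The converse fails because the points of \<open>\<gamma> A \<inter> X0\<close> may be produced by points of \<open>A\<close>
  outside \<open>X0\<close>, and restriction to \<open>X0\<close> deletes these; an operation for which a single point
  outside \<open>X0\<close> produces everything shows this.
\<close>

text \<open>
  An open set of the sum is recovered from its slices, which serve as the family \<open>N\<close>; conversely
  the slices of \<open>Sigma J N\<close> over \<open>J\<close> are the sets \<open>N \<alpha>\<close>.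
\<close>
lemma gt_of_sum_op:
  "(Sigma J X, gt_of (Sigma J X) (sum_op J X \<gamma>)) =
     gts_sum J (\<lambda>\<alpha>. (X \<alpha>, gt_of (X \<alpha>) (\<gamma> \<alpha>)))"
proof -
  have "A \<in> gt_of (Sigma J X) (sum_op J X \<gamma>) \<longleftrightarrow>
      (\<exists>N. A = Sigma J N \<and> (\<forall>\<alpha>\<in>J. N \<alpha> \<in> gt_of (X \<alpha>) (\<gamma> \<alpha>)))" for A
  proof
    assume A: "A \<in> gt_of (Sigma J X) (sum_op J X \<gamma>)"
    then have sub: "A \<subseteq> Sigma J X" and op: "A \<subseteq> sum_op J X \<gamma> A"
      by (auto simp: gt_of_def)
    have "A = Sigma J (\<lambda>\<alpha>. Pair \<alpha> -` A \<inter> X \<alpha>)" using sub by auto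
    moreover have "Pair \<alpha> -` A \<inter> X \<alpha> \<in> gt_of (X \<alpha>) (\<gamma> \<alpha>)" for \<alpha>
      using op by (auto simp: gt_of_def sum_op_def)
    ultimately show "\<exists>N. A = Sigma J N \<and> (\<forall>\<alpha>\<in>J. N \<alpha> \<in> gt_of (X \<alpha>) (\<gamma> \<alpha>))"
      by (intro exI[of _ "\<lambda>\<alpha>. Pair \<alpha> -` A \<inter> X \<alpha>"] conjI ballI)
  next
    assume "\<exists>N. A = Sigma J N \<and> (\<forall>\<alpha>\<in>J. N \<alpha> \<in> gt_of (X \<alpha>) (\<gamma> \<alpha>))"
    then obtain N where A: "A = Sigma J N"
      and N: "\<And>\<alpha>. \<alpha> \<in> J \<Longrightarrow> N \<alpha> \<subseteq> X \<alpha> \<and> N \<alpha> \<subseteq> \<gamma> \<alpha> (N \<alpha>)"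
      by (auto simp: gt_of_def)
    have "Pair \<alpha> -` A \<inter> X \<alpha> = N \<alpha>" if "\<alpha> \<in> J" for \<alpha>
      using A N[OF that] that by auto
    then have "sum_op J X \<gamma> A = Sigma J (\<lambda>\<alpha>. \<gamma> \<alpha> (N \<alpha>))"
      unfolding sum_op_def by (intro Sigma_cong refl) simp
    then show "A \<in> gt_of (Sigma J X) (sum_op J X \<gamma>)"
      unfolding gt_of_def using A N by blast
  qed
  then show ?thesis by (auto simp: gts_sum_def)
qed

lemma gt_of_subspace_op_subset:
  assumes "X0 \<subseteq> X"
  shows "gt_of X0 (subspace_op X0 \<gamma>) \<subseteq> restrict_family (gt_of X \<gamma>) X0"
proof
  fix A assume "A \<in> gt_of X0 (subspace_op X0 \<gamma>)"
  then have "A \<in> gt_of X \<gamma>" "A = A \<inter> X0"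
    using assms by (auto simp: gt_of_def subspace_op_def)
  then show "A \<in> restrict_family (gt_of X \<gamma>) X0"
    unfolding restrict_family_def by blast
qed

definition all_if_contains :: "'a \<Rightarrow> 'a set \<Rightarrow> 'a set \<Rightarrow> 'a set" where
  "all_if_contains p X A = (if p \<in> A then X else {})"

lemma completely_additive_all_if_contains:
  "completely_additive X (all_if_contains p X)"
  by (auto simp: completely_additive_def all_if_contains_def)

lemma image_all_if_contains:
  assumes "p \<in> X"
  shows "all_if_contains p X ` Pow X = {{}, X}"
proof -
  have "all_if_contains p X {} = {}" "all_if_contains p X X = X"
    using assms by (auto simp: all_if_contains_def)
  then have "{{}, X} \<subseteq> all_if_contains p X ` Pow X"
    by (metis Pow_bottom Pow_top empty_subsetI image_eqI insert_subset)
  then show ?thesis by (auto simp: all_if_contains_def)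
qed

text \<open>
  The whole space is open, with nonempty trace \<open>X0\<close>. Within \<open>X0\<close> no set contains \<open>p\<close>, so the
  restricted operation is constantly empty and only the empty set is open.
\<close>
lemma restriction_not_subset_all_if_contains:
  assumes "X0 \<subseteq> X" "X0 \<noteq> {}" "p \<in> X - X0"
  shows "\<not> restrict_family (gt_of X (all_if_contains p X)) X0
           \<subseteq> gt_of X0 (subspace_op X0 (all_if_contains p X))"
proof -
  have "X \<in> gt_of X (all_if_contains p X)"
    using assms by (simp add: gt_of_def all_if_contains_def)
  moreover have "X0 = X \<inter> X0" using assms by blast
  ultimately have "X0 \<in> restrict_family (gt_of X (all_if_contains p X)) X0"
    unfolding restrict_family_def by blast
  moreover have "X0 \<notin> gt_of X0 (subspace_op X0 (all_if_contains p X))"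
    using assms by (simp add: gt_of_def subspace_op_def all_if_contains_def)
  ultimately show ?thesis by blast
qed

theorem proposition5p1:
  "(\<forall>(J :: 'i set) (X :: 'i \<Rightarrow> 'a set) \<gamma>.
      (\<forall>\<alpha>\<in>J. monotonous (X \<alpha>) (\<gamma> \<alpha>)) \<longrightarrow>
      (Sigma J X, gt_of (Sigma J X) (sum_op J X \<gamma>)) =
        gts_sum J (\<lambda>\<alpha>. (X \<alpha>, gt_of (X \<alpha>) (\<gamma> \<alpha>)))) \<and>
   (\<forall>(X :: 'b set) X0 \<gamma>.
      monotonous X \<gamma> \<longrightarrow> X0 \<subseteq> X \<longrightarrow>
      gt_of X0 (subspace_op X0 \<gamma>) \<subseteq> restrict_family (gt_of X \<gamma>) X0) \<and>
   (\<exists>(X :: nat set) X0 \<gamma>.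
      X0 \<subseteq> X \<and> completely_additive X \<gamma> \<and> \<gamma> ` Pow X = {{}, X} \<and>
      \<not> restrict_family (gt_of X \<gamma>) X0 \<subseteq> gt_of X0 (subspace_op X0 \<gamma>))"
proof (intro conjI allI impI)
  show "\<exists>(X :: nat set) X0 \<gamma>.
      X0 \<subseteq> X \<and> completely_additive X \<gamma> \<and> \<gamma> ` Pow X = {{}, X} \<and>
      \<not> restrict_family (gt_of X \<gamma>) X0 \<subseteq> gt_of X0 (subspace_op X0 \<gamma>)"
  proof (intro exI conjI)
    show "{0} \<subseteq> {0, 1 :: nat}" by simp
    show "completely_additive {0, 1 :: nat} (all_if_contains 1 {0, 1})"
      by (rule completely_additive_all_if_contains)
    show "all_if_contains 1 {0, 1 :: nat} ` Pow {0, 1} = {{}, {0, 1}}"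
      by (rule image_all_if_contains) simp
    show "\<not> restrict_family (gt_of {0, 1 :: nat} (all_if_contains 1 {0, 1})) {0}
             \<subseteq> gt_of {0} (subspace_op {0} (all_if_contains 1 {0, 1}))"
      by (rule restriction_not_subset_all_if_contains) simp_all
  qed
qed (simp_all only: gt_of_sum_op gt_of_subspace_op_subset)

end
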